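(* Let $E$ be a finite-dimensional real vector space, $Q\subset E$ nonempty, convex and compact, and $h:Q\to\mathbb{R}$ concave and differentiable on $Q$, with finite curvature constant $C_{h,Q}$. Let $\{\lambda_k\}_{k\ge1}$, $\{\tilde\lambda_k\}_{k\ge 1}$ and $\{B_k\}_{k\ge 0}$ be the iterates and upper bounds on $h^*=\max_{\lambda\in Q}h(\lambda)$ generated by the Frank-Wolfe method with an arbitrary step-size sequence $\{\bar\alpha_k\}_{k\ge 1}\subset[0,1)$, and let $\{\alpha_k\},\{\beta_k\}$ be the associated dual averages sequences. Then for every $k\ge 0$: $$B_k-h(\lambda_{k+1})\le \frac{B_k-h(\lambda_1)}{\beta_{k+1}}+\frac{\frac12 C_{h,Q}\sum_{i=1}^k\frac{\alpha_i^2}{\beta_{i+1}}}{\beta_{k+1}}.$$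
   Context: Notation: $E^*$ is the dual space of $E$ and $s^T\lambda$ is the evaluation of $s\in E^*$ at $\lambda\in E$; $\nabla h(\lambda)\in E^*$. Curvature constant: $C_{h,Q}$ is the minimal $C$ such that $h(\lambda+\alpha(\bar\lambda-\lambda))\ge h(\lambda)+\nabla h(\lambda)^T(\alpha(\bar\lambda-\lambda))-\frac12 C\alpha^2$ for all $\lambda,\bar\lambda\in Q$ and all $\alpha\in[0,1]$ (assumed finite). Frank-Wolfe method for maximizing $h$ over $Q$: start at $\lambda_1\in Q$ with an upper bound $B_0\ge h^*$ ($B_0=+\infty$ allowed if no bound is available, inequalities being then read in the extended reals). At iteration $k\ge1$: choose $\tilde\lambda_k\in\arg\max_{\lambda\in Q}\{h(\lambda_k)+\nabla h(\lambda_k)^T(\lambda-\lambda_k)\}$; set $B^w_k=h(\lambda_k)+\nabla h(\lambda_k)^T(\tilde\lambda_k-\lambda_k)$; set $B_k=\min\{B_{k-1},B^w_k,B^o_k\}$, where $B^o_k\ge h^*$ is any other (optional) upper bound on $h^*$ (omitted, or $+\infty$, if not computed); set $\lambda_{k+1}=\lambda_k+\bar\alpha_k(\tilde\lambda_k-\lambda_k)$ with $\bar\alpha_k\in[0,1)$. Dual averages sequences: $\beta_k=\frac{1}{\prod_{j=1}^{k-1}(1-\bar\alpha_j)}$ and $\alpha_k=\frac{\beta_k\bar\alpha_k}{1-\bar\alpha_k}$ for $k\ge1$. Empty products equal $1$, empty sums equal $0$. *)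

theory Defs
  imports "HOL-Analysis.Analysis"
begin

text \<open>
  The gradient of \<open>h\<close> is a map \<open>dh\<close> from points to the dual space
  \<open>'a \<Rightarrow>\<^sub>L real\<close>. Only the values of \<open>h\<close> and \<open>dh\<close> on \<open>Q\<close> matter below, and
  \<open>dh x\<close> is only evaluated at directions parallel to segments from \<open>x\<close> to points of \<open>Q\<close>, so
  that the non-uniqueness of a derivative relative to a set \<open>Q\<close> with empty interior is harmless.
\<close>

definition curvature_bound ::
  "'a::real_normed_vector set \<Rightarrow> ('a \<Rightarrow> real) \<Rightarrow> ('a \<Rightarrow> 'a \<Rightarrow>\<^sub>L real) \<Rightarrow> real \<Rightarrow> bool" where
  "curvature_bound Q h dh C \<longleftrightarrow>
     (\<forall>x\<in>Q. \<forall>y\<in>Q. \<forall>a\<in>{0..1}.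
        h (x + a *\<^sub>R (y - x)) \<ge> h x + blinfun_apply (dh x) (a *\<^sub>R (y - x)) - 1/2 * C * a\<^sup>2)"

text \<open>Meaningful only when some curvature bound exists (the constant is finite) and
  \<open>Q\<close> is nonempty; the minimum is then attained.\<close>

definition curvature_constant ::
  "'a::real_normed_vector set \<Rightarrow> ('a \<Rightarrow> real) \<Rightarrow> ('a \<Rightarrow> 'a \<Rightarrow>\<^sub>L real) \<Rightarrow> real" where
  "curvature_constant Q h dh = (LEAST C. curvature_bound Q h dh C)"

definition max_value :: "'a set \<Rightarrow> ('a \<Rightarrow> real) \<Rightarrow> real" where
  "max_value Q h = (GREATEST v. v \<in> h ` Q)"

definition linear_model ::
  "('a::real_normed_vector \<Rightarrow> real) \<Rightarrow> ('a \<Rightarrow> 'a \<Rightarrow>\<^sub>L real) \<Rightarrow> 'a \<Rightarrow> 'a \<Rightarrow> real" where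
  "linear_model h dh x y = h x + blinfun_apply (dh x) (y - x)"

text \<open>
  \<open>abar\<close> are the step sizes, \<open>lam\<close> and \<open>lamt\<close> the iterates \<open>\<lambda>\<^sub>k\<close> and the linear maximizers
  of the model at \<open>\<lambda>\<^sub>k\<close>, \<open>B\<close> the upper bounds, and \<open>Bo\<close> the optional bounds, equal to \<open>\<infinity>\<close>
  where no such bound is computed. All sequences but \<open>B\<close> start at index 1.
\<close>

definition frank_wolfe ::
  "'a::real_normed_vector set \<Rightarrow> ('a \<Rightarrow> real) \<Rightarrow> ('a \<Rightarrow> 'a \<Rightarrow>\<^sub>L real) \<Rightarrow> (nat \<Rightarrow> real) \<Rightarrow>
   (nat \<Rightarrow> 'a) \<Rightarrow> (nat \<Rightarrow> 'a) \<Rightarrow> (nat \<Rightarrow> ereal) \<Rightarrow> (nat \<Rightarrow> ereal) \<Rightarrow> bool" where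
  "frank_wolfe Q h dh abar lam lamt B Bo \<longleftrightarrow>
     lam 1 \<in> Q \<and> B 0 \<ge> ereal (max_value Q h) \<and>
     (\<forall>k\<ge>1.
        0 \<le> abar k \<and> abar k < 1 \<and>
        is_arg_max (linear_model h dh (lam k)) (\<lambda>y. y \<in> Q) (lamt k) \<and>
        Bo k \<ge> ereal (max_value Q h) \<and>
        B k = min (B (k - 1)) (min (ereal (linear_model h dh (lam k) (lamt k))) (Bo k)) \<and>
        lam (k + 1) = lam k + abar k *\<^sub>R (lamt k - lam k))"

definition da_beta :: "(nat \<Rightarrow> real) \<Rightarrow> nat \<Rightarrow> real" where
  "da_beta abar k = 1 / (\<Prod>j\<in>{1..<k}. 1 - abar j)"

definition da_alpha :: "(nat \<Rightarrow> real) \<Rightarrow> nat \<Rightarrow> real" where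
  "da_alpha abar k = da_beta abar k * abar k / (1 - abar k)"

end

theory Submission
  imports Defs
begin

text \<open>
  Combining the curvature bound with \<open>B\<^sub>k \<le> B\<^sup>w\<^sub>i\<close> for \<open>i \<le> k\<close>, every real \<open>b \<le> B\<^sub>k\<close> satisfies the
  one-step contraction \<open>b - h \<lambda>\<^sub>i\<^sub>+\<^sub>1 \<le> (1 - a\<^sub>i) (b - h \<lambda>\<^sub>i) + C a\<^sub>i\<^sup>2 / 2\<close> in the step sizes \<open>a\<^sub>i\<close>. Since
  \<open>\<beta>\<^sub>i\<^sub>+\<^sub>1 = \<beta>\<^sub>i / (1 - a\<^sub>i)\<close>, multiplying by \<open>\<beta>\<^sub>i\<^sub>+\<^sub>1\<close> makes these inequalities telescope with \<open>b\<close> fixed.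
\<close>

lemma curvature_bound_nonneg:
  assumes "curvature_bound Q h dh C" and "Q \<noteq> {}"
  shows "0 \<le> C"
proof -
  obtain x where "x \<in> Q" using \<open>Q \<noteq> {}\<close> by blast
  \<comment> \<open>On the degenerate segment from \<open>x\<close> to itself the function and
    linear terms cancel, and step size 1 leaves exactly \<open>0 \<le> C\<close>.\<close>
  then have "h (x + 1 *\<^sub>R (x - x)) \<ge> h x + blinfun_apply (dh x) (1 *\<^sub>R (x - x)) - 1/2 * C * 1\<^sup>2"
    using assms(1) unfolding curvature_bound_def by (meson atLeastAtMost_iff order_refl zero_le_one)
  then show ?thesis by simp
qed

text \<open>\<open>LEAST\<close> over the reals is informative only if the minimum is attained. Here
  the admissible constants form an intersection of closed sets, each cut out by an inequality affine
  in \<open>C\<close>. This intersection is nonempty and bounded below by 0, so it contains its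
  infimum.\<close>

lemma curvature_bound_curvature_constant:
  assumes "curvature_bound Q h dh C0" and "Q \<noteq> {}"
  shows "curvature_bound Q h dh (curvature_constant Q h dh)"
proof -
  let ?S = "{C. curvature_bound Q h dh C}"
  have below: "bdd_below ?S"
    using curvature_bound_nonneg[OF _ \<open>Q \<noteq> {}\<close>] by (intro bdd_belowI[of _ 0]) blast
  have "?S = (\<Inter>x\<in>Q. \<Inter>y\<in>Q. \<Inter>a\<in>{0..1}.
      {C. h x + blinfun_apply (dh x) (a *\<^sub>R (y - x)) - 1/2 * C * a\<^sup>2 \<le> h (x + a *\<^sub>R (y - x))})"
    unfolding curvature_bound_def by auto
  moreover have "closed \<dots>"
    by (intro closed_INT ballI closed_Collect_le continuous_intros)
  ultimately have "closed ?S" by simp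
  then have mem: "Inf ?S \<in> ?S"
    using closed_contains_Inf[of ?S] assms(1) below by blast
  then have "curvature_constant Q h dh = Inf ?S"
    unfolding curvature_constant_def by (intro Least_equality) (auto intro: cInf_lower below)
  with mem show ?thesis by simp
qed

lemma da_beta_1 [simp]: "da_beta abar (Suc 0) = 1"
  by (simp add: da_beta_def)

lemma da_beta_Suc:
  assumes "1 \<le> k"
  shows "da_beta abar (Suc k) = da_beta abar k / (1 - abar k)"
  using assms by (simp add: da_beta_def prod.atLeastLessThan_Suc)

lemma da_beta_pos:
  assumes "\<And>j. 1 \<le> j \<Longrightarrow> j < k \<Longrightarrow> abar j < 1"
  shows "0 < da_beta abar k"
  unfolding da_beta_def using assms by (auto intro!: divide_pos_pos prod_pos)

text \<open>The recursion is isolated from the method: \<open>e\<close> will be the gap to a fixed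
  level and \<open>c\<close> half the curvature constant. No sign condition on \<open>e\<close> or
  \<open>c\<close> enters; only \<open>1 - abar i\<close> must be positive.\<close>

lemma contraction_telescope:
  fixes e abar :: "nat \<Rightarrow> real"
  assumes "\<And>i. 1 \<le> i \<Longrightarrow> i \<le> k \<Longrightarrow> abar i < 1"
    and "\<And>i. 1 \<le> i \<Longrightarrow> i \<le> k \<Longrightarrow> e (Suc i) \<le> (1 - abar i) * e i + c * (abar i)\<^sup>2"
  shows "e (Suc k) \<le> e 1 / da_beta abar (Suc k)
    + c * (\<Sum>i=1..k. (da_alpha abar i)\<^sup>2 / da_beta abar (Suc i)) / da_beta abar (Suc k)"
  using assms
proof (induction k)
  case 0
  then show ?case by simp
next
  case (Suc k)
  define a where "a = abar (Suc k)"
  define b where "b = da_beta abar (Suc k)"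
  define S where "S = (\<Sum>i=1..k. (da_alpha abar i)\<^sup>2 / da_beta abar (Suc i))"
  have a: "0 < 1 - a" using Suc.prems(1)[of "Suc k"] by (simp add: a_def)
  have b: "0 < b" unfolding b_def by (rule da_beta_pos) (use Suc.prems(1) in auto)
  have beta: "da_beta abar (Suc (Suc k)) = b / (1 - a)"
    unfolding a_def b_def by (rule da_beta_Suc) simp
  \<comment> \<open>Each summand is the squared step size weighted by the next
    \<open>da_beta\<close>. Dividing the new one by that same \<open>da_beta\<close> thus returns
    the error \<open>a\<^sup>2\<close> of the current step.\<close>
  have summand: "(da_alpha abar (Suc k))\<^sup>2 / da_beta abar (Suc (Suc k)) = b * a\<^sup>2 / (1 - a)"
  proof -
    \<comment> \<open>Generalizing \<open>1 - a\<close> to a positive \<open>d\<close> keeps the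
      simplifier from expanding the difference.\<close>
    have "(b * a / d)\<^sup>2 / (b / d) = b * a\<^sup>2 / d" if "0 < d" for d
      using b that by (simp add: field_simps power2_eq_square)
    from this[OF a] show ?thesis
      unfolding beta da_alpha_def a_def[symmetric] b_def[symmetric] .
  qed
  have "e (Suc (Suc k)) \<le> (1 - a) * e (Suc k) + c * a\<^sup>2"
    using Suc.prems(2)[of "Suc k"] by (simp add: a_def)
  also have "\<dots> \<le> (1 - a) * (e 1 / b + c * S / b) + c * a\<^sup>2"
    using Suc.IH Suc.prems a by (intro add_right_mono mult_left_mono) (auto simp: b_def S_def)
  also have "\<dots> = e 1 / (b / (1 - a)) + c * (S + b * a\<^sup>2 / (1 - a)) / (b / (1 - a))"
    using a b by (simp add: field_simps)
  also have "S + b * a\<^sup>2 / (1 - a) = (\<Sum>i=1..Suc k. (da_alpha abar i)\<^sup>2 / da_beta abar (Suc i))"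
    by (simp add: S_def flip: summand)
  finally show ?case
    by (simp only: beta)
qed

lemma frank_wolfe_step_size:
  assumes "frank_wolfe Q h dh abar lam lamt B Bo" and "1 \<le> k"
  shows "0 \<le> abar k" and "abar k < 1"
  using assms by (auto simp: frank_wolfe_def)

lemma frank_wolfe_lamt_mem:
  assumes "frank_wolfe Q h dh abar lam lamt B Bo" and "1 \<le> k"
  shows "lamt k \<in> Q"
  using assms by (auto simp: frank_wolfe_def is_arg_max_def)

lemma frank_wolfe_lam_Suc:
  assumes "frank_wolfe Q h dh abar lam lamt B Bo" and "1 \<le> k"
  shows "lam (Suc k) = lam k + abar k *\<^sub>R (lamt k - lam k)"
  using assms by (auto simp: frank_wolfe_def)

lemma frank_wolfe_lam_mem:
  assumes "frank_wolfe Q h dh abar lam lamt B Bo" and "convex Q" and "1 \<le> k"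
  shows "lam k \<in> Q"
  using \<open>1 \<le> k\<close>
proof (induction k rule: dec_induct)
  case base
  then show ?case using assms(1) by (simp add: frank_wolfe_def)
next
  case (step k)
  \<comment> \<open>The update is rewritten as a convex combination, so convexity keeps the iterate
    in \<open>Q\<close>.\<close>
  have "lam (Suc k) = (1 - abar k) *\<^sub>R lam k + abar k *\<^sub>R lamt k"
    using frank_wolfe_lam_Suc[OF assms(1)] step.hyps by (simp add: algebra_simps)
  then show ?case
    using step frank_wolfe_step_size[OF assms(1)] frank_wolfe_lamt_mem[OF assms(1)]
    by (auto intro!: convexD_alt[OF \<open>convex Q\<close>] simp: less_imp_le)
qed

text \<open>Taking the minimum with the previous bound makes \<open>B\<close> nonincreasing, so the
  last bound lies below the linear-model value of every earlier iteration. This is what allows one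
  level to serve in all steps.\<close>

lemma frank_wolfe_bound_le_linear_model:
  assumes "frank_wolfe Q h dh abar lam lamt B Bo" and "1 \<le> i" and "i \<le> k"
  shows "B k \<le> ereal (linear_model h dh (lam i) (lamt i))"
proof -
  have B: "B k = min (B (k - 1)) (min (ereal (linear_model h dh (lam k) (lamt k))) (Bo k))"
    if "1 \<le> k" for k
    using assms(1) that by (simp add: frank_wolfe_def)
  have "B (Suc n) \<le> B n" for n
    using B[of "Suc n"] by simp
  then have "B k \<le> B i"
    using \<open>i \<le> k\<close> by (rule lift_Suc_antimono_le)
  also have "\<dots> \<le> ereal (linear_model h dh (lam i) (lamt i))"
    using B[OF \<open>1 \<le> i\<close>] by (simp add: min_le_iff_disj)
  finally show ?thesis .
qed

lemma frank_wolfe_contraction: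
  assumes "frank_wolfe Q h dh abar lam lamt B Bo" and "convex Q" and "curvature_bound Q h dh C"
    and "1 \<le> i" and b: "b \<le> linear_model h dh (lam i) (lamt i)"
  shows "b - h (lam (Suc i)) \<le> (1 - abar i) * (b - h (lam i)) + 1/2 * C * (abar i)\<^sup>2"
proof -
  note a = frank_wolfe_step_size[OF assms(1) \<open>1 \<le> i\<close>]
  define g where "g = blinfun_apply (dh (lam i)) (lamt i - lam i)"
  have "h (lam (Suc i)) \<ge> h (lam i)
      + blinfun_apply (dh (lam i)) (abar i *\<^sub>R (lamt i - lam i)) - 1/2 * C * (abar i)\<^sup>2"
    using assms(3) a frank_wolfe_lam_mem[OF assms(1,2,4)] frank_wolfe_lamt_mem[OF assms(1,4)]
    unfolding frank_wolfe_lam_Suc[OF assms(1,4)] curvature_bound_def by auto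
  then have "h (lam (Suc i)) \<ge> h (lam i) + abar i * g - 1/2 * C * (abar i)\<^sup>2"
    by (simp add: g_def blinfun.scaleR_right)
  \<comment> \<open>The bound on \<open>b\<close> says that \<open>g\<close> is at least the current
    gap \<open>b - h (lam i)\<close>; scaling by the nonnegative step size turns the linear gain
    into a reduction of that gap.\<close>
  moreover have "abar i * b \<le> abar i * (h (lam i) + g)"
    using a(1) b by (intro mult_left_mono) (auto simp: g_def linear_model_def)
  ultimately show ?thesis
    by (simp add: algebra_simps)
qed

theorem theorem2p1:
  fixes Q :: "'a::real_normed_vector set"
    and h :: "'a \<Rightarrow> real"
    and dh :: "'a \<Rightarrow> 'a \<Rightarrow>\<^sub>L real"
    and abar :: "nat \<Rightarrow> real"
    and lam lamt :: "nat \<Rightarrow> 'a"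
    and B Bo :: "nat \<Rightarrow> ereal"
    and k :: nat
  assumes "\<exists>S::'a set. finite S \<and> span S = UNIV"
    and "Q \<noteq> {}" and "convex Q" and "compact Q"
    and "concave_on Q h"
    and "\<And>x. x \<in> Q \<Longrightarrow> (h has_derivative blinfun_apply (dh x)) (at x within Q)"
    and "\<exists>C. curvature_bound Q h dh C"
    and "frank_wolfe Q h dh abar lam lamt B Bo"
  shows "B k - ereal (h (lam (k + 1)))
    \<le> (B k - ereal (h (lam 1))) / ereal (da_beta abar (k + 1))
      + ereal ((1/2 * curvature_constant Q h dh
                  * (\<Sum>i=1..k. (da_alpha abar i)\<^sup>2 / da_beta abar (i + 1)))
               / da_beta abar (k + 1))"
proof -
  obtain C0 where "curvature_bound Q h dh C0" using assms(7) by blast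
  then have C: "curvature_bound Q h dh (curvature_constant Q h dh)"
    using \<open>Q \<noteq> {}\<close> by (rule curvature_bound_curvature_constant)
  have beta: "0 < da_beta abar (k + 1)"
    using frank_wolfe_step_size[OF assms(8)] by (intro da_beta_pos) simp
  show ?thesis
  \<comment> \<open>The real case carries the argument. An infinite initial bound makes the right
    side infinite at \<open>k = 0\<close>, since \<open>da_beta\<close> is positive; for a bound of
    minus infinity the left side is minus infinity.\<close>
  proof (cases "B k")
    case (real b)
    have "b \<le> linear_model h dh (lam i) (lamt i)" if "1 \<le> i" "i \<le> k" for i
      using frank_wolfe_bound_le_linear_model[OF assms(8) that] real by simp
    \<comment> \<open>The level \<open>b\<close> is the final bound \<open>B k\<close>, held fixed
      over all earlier steps.\<close>
    then have "b - h (lam (Suc k)) \<le> (b - h (lam 1)) / da_beta abar (Suc k)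
      + 1/2 * curvature_constant Q h dh
        * (\<Sum>i=1..k. (da_alpha abar i)\<^sup>2 / da_beta abar (Suc i)) / da_beta abar (Suc k)"
      using frank_wolfe_step_size[OF assms(8)]
        frank_wolfe_contraction[OF assms(8) \<open>convex Q\<close> C]
      by (intro contraction_telescope[where e = "\<lambda>i. b - h (lam i)"]) auto
    then show ?thesis
      using beta real by simp
  next
    case PInf
    then show ?thesis using beta by simp
  next
    case MInf
    then show ?thesis by simp
  qed
qed

end
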